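(* Let $\Theta\subset\mathbb{R}^{n_\theta}$ and let $\theta^*\in\Theta$. Consider, for $\theta\in\Theta$, the system with zero input $$\dot x = A(\theta^* )x,\qquad \dot e=\Delta A(\theta)x+A(\theta)e,\qquad \Delta y=\Delta C(\theta)x+C(\theta)e,$$ with initial conditions $x(0)=x_0\in\mathbb{R}^n$ and $e(0)=0$. Suppose there exist a function $V:\mathbb{R}^n\times\mathbb{R}^n\times\mathbb{R}^{n_\theta}\to\mathbb{R}_{\ge 0}$, $V\in\mathcal{C}^1$, $V(0,0,\cdot)=0$, and functions $p_i:\mathbb{R}^{n_\theta}\to\mathbb{R}_{\ge0}$, $i=1,2$, such that for all $\theta\in\Theta$ and all $(x,e)\in\mathbb{R}^n\times\mathbb{R}^n$, $$V(x,e,\theta)\le p_1(\theta)\|x\|^2+p_2(\theta)\|e\|^2,$$ and $$\dot V(x,e,\theta)\le-(\Delta y)^T(\Delta y)$$ along the trajectories of the system. Then, for any initial condition $x(0)=x_0\neq 0$, $e(0)=0$, $$\frac{\|\Delta y\|_2^2}{\|x_0\|^2}\le p_1(\theta)\qquad\forall\theta\in\Theta.$$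
   Context: The data are functions $A:\mathbb{R}^{n_\theta}\to\mathbb{R}^{n\times n}$ and $C:\mathbb{R}^{n_\theta}\to\mathbb{R}^{p\times n}$ (no assumption on the form of the dependence on $\theta$), with $A(\theta)$ Hurwitz for all $\theta\in\Theta$. The fixed $\theta^*\in\Theta$ is the nominal parameter value, and $\Delta A(\theta):=A(\theta^* )-A(\theta)$, $\Delta C(\theta):=C(\theta^* )-C(\theta)$. The system arises from the nominal system $\dot x=A(\theta^* )x$, $y=C(\theta^* )x$ and the uncertain system $\dot{\tilde x}=A(\theta)\tilde x$, $\tilde y=C(\theta)\tilde x$, $\tilde x(0)=x(0)=x_0$, by setting $e=x-\tilde x$, $\Delta y=y-\tilde y$. Here $\dot V(x,e,\theta)=\frac{\partial V}{\partial x}A(\theta^* )x+\frac{\partial V}{\partial e}\left(\Delta A(\theta)x+A(\theta)e\right)$ is the derivative of $V$ along trajectories for the constant parameter $\theta$, $\|\cdot\|$ is the Euclidean norm, and $\|\Delta y\|_2^2=\int_0^\infty \Delta y(t)^T\Delta y(t)\,dt$. *)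

theory Defs
  imports "HOL-Analysis.Analysis"
begin

definition eigenvalue_of :: "complex^'n^'n \<Rightarrow> complex \<Rightarrow> bool" where
  "eigenvalue_of M \<mu> \<longleftrightarrow> (\<exists>v. v \<noteq> 0 \<and> M *v v = \<mu> *s v)"

definition hurwitz :: "real^'n^'n \<Rightarrow> bool" where
  "hurwitz M \<longleftrightarrow> (\<forall>\<mu>. eigenvalue_of (map_matrix complex_of_real M) \<mu> \<longrightarrow> Re \<mu> < 0)"

definition continuously_differentiable ::
    "('a::real_normed_vector \<Rightarrow> 'b::real_normed_vector) \<Rightarrow> bool" where
  "continuously_differentiable f \<longleftrightarrow>
     (\<exists>f'. (\<forall>z. (f has_derivative blinfun_apply (f' z)) (at z)) \<and> continuous_on UNIV f')"

definition Delta :: "'t \<Rightarrow> ('t \<Rightarrow> 'm::minus) \<Rightarrow> 't \<Rightarrow> 'm" where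
  "Delta \<theta>s M \<theta> = M \<theta>s - M \<theta>"

definition error_field ::
    "('t \<Rightarrow> real^'n^'n) \<Rightarrow> 't \<Rightarrow> 't \<Rightarrow> real^'n \<Rightarrow> real^'n \<Rightarrow> real^'n" where
  "error_field A \<theta>s \<theta> x e = Delta \<theta>s A \<theta> *v x + A \<theta> *v e"

definition output_error ::
    "('t \<Rightarrow> real^'n^'p) \<Rightarrow> 't \<Rightarrow> 't \<Rightarrow> real^'n \<Rightarrow> real^'n \<Rightarrow> real^'p" where
  "output_error C \<theta>s \<theta> x e = Delta \<theta>s C \<theta> *v x + C \<theta> *v e"

definition trajectory ::
    "('t \<Rightarrow> real^'n^'n) \<Rightarrow> 't \<Rightarrow> 't \<Rightarrow> (real \<Rightarrow> real^'n) \<Rightarrow> (real \<Rightarrow> real^'n) \<Rightarrow> bool" where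
  "trajectory A \<theta>s \<theta> x e \<longleftrightarrow>
     (\<forall>t\<ge>0. (x has_vector_derivative A \<theta>s *v x t) (at t within {0..}) \<and>
            (e has_vector_derivative error_field A \<theta>s \<theta> (x t) (e t)) (at t within {0..}))"

definition V_dot ::
    "('t \<Rightarrow> real^'n^'n) \<Rightarrow> 't \<Rightarrow> ((real^'n) \<times> (real^'n) \<times> 't \<Rightarrow> real) \<Rightarrow>
      real^'n \<Rightarrow> real^'n \<Rightarrow> 't \<Rightarrow> real" where
  "V_dot A \<theta>s V x e \<theta> =
     frechet_derivative (\<lambda>x'. V (x', e, \<theta>)) (at x) (A \<theta>s *v x) +
     frechet_derivative (\<lambda>e'. V (x, e', \<theta>)) (at e) (error_field A \<theta>s \<theta> x e)"

(* Values in ennreal: an upper bound then includes square integrability, whereas a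
   real-valued integral would be 0 for a signal that is not square integrable. *)
definition L2_norm_sq :: "(real \<Rightarrow> 'a::real_inner) \<Rightarrow> ennreal" where
  "L2_norm_sq y = (\<integral>\<^sup>+t\<in>{0..}. ennreal (y t \<bullet> y t) \<partial>lborel)"

end

theory Submission
  imports Defs
begin

text \<open>
  The function \<open>V\<close> is a storage function: along a trajectory, with \<open>\<theta>\<close> held constant, the stored value
  \<open>W t = V (x t, e t, \<theta>)\<close> decreases at least at the rate \<open>\<Delta>y t \<bullet> \<Delta>y t\<close>. So the integral
  of \<open>\<Delta>y t \<bullet> \<Delta>y t\<close> over \<open>[0, T]\<close> is at most \<open>W 0 - W T\<close>, hence at most \<open>W 0\<close> because \<open>V\<close> is
  nonnegative. This bound does not depend on \<open>T\<close>, so it persists for the integral over the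
  half-line (\<open>dissipation_inequality\<close>), and finiteness of the \<open>L\<^sup>2\<close> norm is part of the conclusion.
  Since \<open>e 0 = 0\<close>, the quadratic upper bound on \<open>V\<close> reduces to \<open>W 0 \<le> p1 \<theta> * (norm x0)\<^sup>2\<close>, which is the claim.

  That \<open>V_dot\<close> really is the derivative of \<open>W\<close> is the chain rule: \<open>V\<close> is totally differentiable, so the two
  partial derivatives in \<open>V_dot\<close> are the restrictions of its differential to the coordinate
  subspaces (\<open>storage_has_derivative_V_dot\<close>).
\<close>

text \<open>
  The half-line is exhausted by the intervals \<open>[0, n]\<close>; monotone convergence carries a bound that is
  uniform in \<open>n\<close> to the limit.
\<close>
lemma nn_integral_atLeast_le_of_integral_Icc_le:
  fixes g :: "real \<Rightarrow> real"
  assumes cont: "continuous_on {0..} g"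
    and nonneg: "\<And>t. 0 \<le> t \<Longrightarrow> 0 \<le> g t"
    and bound: "\<And>T. 0 \<le> T \<Longrightarrow> integral {0..T} g \<le> B"
  shows "(\<integral>\<^sup>+t\<in>{0..}. ennreal (g t) \<partial>lborel) \<le> ennreal B"
proof -
  let ?f = "\<lambda>n t. ennreal (g t) * indicator {0..real n} t"
  have cont_Icc: "continuous_on {0..real n} g" for n
    using cont by (rule continuous_on_subset) auto
  have meas: "?f n \<in> borel_measurable lborel" for n
  proof -
    have "(\<lambda>t. indicator {0..real n} t *\<^sub>R g t) \<in> borel_measurable borel"
      by (intro borel_measurable_continuous_on_indicator cont_Icc) auto
    then have "(\<lambda>t. ennreal (indicator {0..real n} t *\<^sub>R g t)) \<in> borel_measurable lborel"
      by simp
    also have "(\<lambda>t. ennreal (indicator {0..real n} t *\<^sub>R g t)) = ?f n"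
      by (auto simp: indicator_def)
    finally show ?thesis .
  qed
  have inc: "incseq ?f"
    by (auto simp: incseq_def le_fun_def indicator_def)
  have sup: "(SUP n. ?f n t) = ennreal (g t) * indicator {0..} t" for t
  proof (rule antisym)
    show "(SUP n. ?f n t) \<le> ennreal (g t) * indicator {0..} t"
      by (rule SUP_least) (auto simp: indicator_def)
    obtain n where "t \<le> real n"
      using real_arch_simple by blast
    then have "ennreal (g t) * indicator {0..} t = ?f n t"
      by (auto simp: indicator_def)
    also have "\<dots> \<le> (SUP n. ?f n t)"
      by (rule SUP_upper) simp
    finally show "ennreal (g t) * indicator {0..} t \<le> (SUP n. ?f n t)" .
  qed
  have "(\<integral>\<^sup>+t\<in>{0..}. ennreal (g t) \<partial>lborel) = (SUP n. integral\<^sup>N lborel (?f n))"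
    unfolding sup[symmetric] by (rule nn_integral_monotone_convergence_SUP[OF inc meas])
  also have "\<dots> \<le> ennreal B"
  proof (rule SUP_least)
    fix n :: nat
    have "(g has_integral integral {0..real n} g) {0..real n}"
      by (intro integrable_integral integrable_continuous_real cont_Icc)
    then have "integral\<^sup>N lborel (?f n) = ennreal (integral {0..real n} g)"
      by (intro nn_integral_has_integral_lebesgue') (auto intro: nonneg)
    also have "\<dots> \<le> ennreal B"
      by (intro ennreal_leI bound) simp
    finally show "integral\<^sup>N lborel (?f n) \<le> ennreal B" .
  qed
  finally show ?thesis .
qed

text \<open>
  The supply \<open>g\<close> extracted up to time \<open>T\<close> is at most the loss \<open>W 0 - W T\<close>, by the fundamental theorem of
  calculus in its gauge-integral form, in which every derivative is integrable.
\<close>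
lemma dissipation_inequality:
  fixes W W' g :: "real \<Rightarrow> real"
  assumes deriv: "\<And>t. 0 \<le> t \<Longrightarrow> (W has_vector_derivative W' t) (at t within {0..})"
    and decay: "\<And>t. 0 \<le> t \<Longrightarrow> W' t \<le> - g t"
    and W_nonneg: "\<And>t. 0 \<le> t \<Longrightarrow> 0 \<le> W t"
    and cont: "continuous_on {0..} g"
    and g_nonneg: "\<And>t. 0 \<le> t \<Longrightarrow> 0 \<le> g t"
  shows "(\<integral>\<^sup>+t\<in>{0..}. ennreal (g t) \<partial>lborel) \<le> ennreal (W 0)"
proof (rule nn_integral_atLeast_le_of_integral_Icc_le[OF cont g_nonneg])
  fix T :: real
  assume T: "0 \<le> T"
  have "(W' has_integral (W T - W 0)) {0..T}"
    by (rule fundamental_theorem_of_calculus[OF T])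
      (auto intro: has_vector_derivative_within_subset[OF deriv])
  then have loss: "((\<lambda>t. - W' t) has_integral - (W T - W 0)) {0..T}"
    by (rule has_integral_neg)
  have "continuous_on {0..T} g"
    using cont by (rule continuous_on_subset) auto
  then have "(g has_integral integral {0..T} g) {0..T}"
    by (intro integrable_integral integrable_continuous_real)
  then have "integral {0..T} g \<le> - (W T - W 0)"
    using loss by (rule has_integral_le) (use decay in force)
  then show "integral {0..T} g \<le> W 0"
    using W_nonneg[OF T] by simp
qed

text \<open>
  For a totally differentiable \<open>V\<close>, the differential at \<open>(x t, e t, \<theta>)\<close> applied to the velocity
  \<open>(x' t, e' t, 0)\<close> splits by linearity into the two partial derivatives that define \<open>V_dot\<close>; the last
  component of the velocity is \<open>0\<close> because the parameter does not vary in time.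
\<close>
lemma storage_has_derivative_V_dot:
  fixes V :: "(real^'n) \<times> (real^'n) \<times> 't::real_normed_vector \<Rightarrow> real"
  assumes V: "\<And>z. (V has_derivative V' z) (at z)"
    and traj: "trajectory A \<theta>s \<theta> x e"
    and t: "0 \<le> t"
  shows "((\<lambda>t. V (x t, e t, \<theta>)) has_vector_derivative V_dot A \<theta>s V (x t) (e t) \<theta>)
           (at t within {0..})"
proof -
  let ?z = "(x t, e t, \<theta>)"
  let ?dx = "A \<theta>s *v x t" and ?de = "error_field A \<theta>s \<theta> (x t) (e t)"
  have "((\<lambda>x'. V (x', e t, \<theta>)) has_derivative (\<lambda>h. V' ?z (h, 0, 0))) (at (x t))"
    by (rule has_derivative_compose[OF _ V]) (auto intro!: derivative_eq_intros simp: zero_prod_def)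
  then have part_x: "frechet_derivative (\<lambda>x'. V (x', e t, \<theta>)) (at (x t)) = (\<lambda>h. V' ?z (h, 0, 0))"
    by (rule frechet_derivative_at[symmetric])
  have "((\<lambda>e'. V (x t, e', \<theta>)) has_derivative (\<lambda>h. V' ?z (0, h, 0))) (at (e t))"
    by (rule has_derivative_compose[OF _ V]) (auto intro!: derivative_eq_intros simp: zero_prod_def)
  then have part_e: "frechet_derivative (\<lambda>e'. V (x t, e', \<theta>)) (at (e t)) = (\<lambda>h. V' ?z (0, h, 0))"
    by (rule frechet_derivative_at[symmetric])
  interpret D: bounded_linear "V' ?z"
    using V by (rule has_derivative_bounded_linear)
  have velocity: "V' ?z (?dx, ?de, 0) = V_dot A \<theta>s V (x t) (e t) \<theta>"
    unfolding V_dot_def part_x part_e D.add[symmetric] by simp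
  have "((\<lambda>t. (x t, e t, \<theta>)) has_vector_derivative (?dx, ?de, 0)) (at t within {0..})"
    using traj t by (auto simp: trajectory_def intro!: derivative_intros)
  then have "(V \<circ> (\<lambda>t. (x t, e t, \<theta>)) has_vector_derivative V' ?z (?dx, ?de, 0))
      (at t within {0..})"
    by (rule vector_derivative_diff_chain_within) (rule has_derivative_at_withinI[OF V])
  then show ?thesis
    unfolding velocity by (simp add: comp_def)
qed

lemma continuous_on_output_error:
  assumes "trajectory A \<theta>s \<theta> x e"
  shows "continuous_on {0..} (\<lambda>t. output_error C \<theta>s \<theta> (x t) (e t))"
proof -
  have "continuous_on {0..} x" "continuous_on {0..} e"
    using assms by (auto simp: trajectory_def continuous_on_eq_continuous_within
      intro: has_vector_derivative_continuous)
  then show ?thesis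
    unfolding output_error_def
    by (intro continuous_on_add linear_continuous_on_compose[OF _ matrix_vector_mul_linear])
qed

theorem proposition3:
  fixes A :: "real^'t \<Rightarrow> real^'n^'n"
    and C :: "real^'t \<Rightarrow> real^'n^'p"
    and \<Theta> :: "(real^'t) set"
    and \<theta>s :: "real^'t"
    and V :: "(real^'n) \<times> (real^'n) \<times> (real^'t) \<Rightarrow> real"
    and p1 p2 :: "real^'t \<Rightarrow> real"
  assumes "\<theta>s \<in> \<Theta>"
    and "\<forall>\<theta>\<in>\<Theta>. hurwitz (A \<theta>)"
    and "\<forall>x e \<theta>. V (x, e, \<theta>) \<ge> 0"
    and "continuously_differentiable V"
    and "\<forall>\<theta>. V (0, 0, \<theta>) = 0"
    and "\<forall>\<theta>. p1 \<theta> \<ge> 0"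
    and "\<forall>\<theta>. p2 \<theta> \<ge> 0"
    and "\<forall>\<theta>\<in>\<Theta>. \<forall>x e. V (x, e, \<theta>) \<le> p1 \<theta> * (norm x)\<^sup>2 + p2 \<theta> * (norm e)\<^sup>2"
    and "\<forall>\<theta>\<in>\<Theta>. \<forall>x e. V_dot A \<theta>s V x e \<theta> \<le>
           - (output_error C \<theta>s \<theta> x e \<bullet> output_error C \<theta>s \<theta> x e)"
  shows "\<forall>x0. x0 \<noteq> 0 \<longrightarrow> (\<forall>\<theta>\<in>\<Theta>. \<forall>x e.
           trajectory A \<theta>s \<theta> x e \<and> x 0 = x0 \<and> e 0 = 0 \<longrightarrow>
           L2_norm_sq (\<lambda>t. output_error C \<theta>s \<theta> (x t) (e t)) / ennreal ((norm x0)\<^sup>2)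
             \<le> ennreal (p1 \<theta>))"
proof (intro allI impI ballI, elim conjE)
  fix x0 :: "real^'n" and \<theta> x e
  assume x0: "x0 \<noteq> 0" and \<theta>: "\<theta> \<in> \<Theta>" and traj: "trajectory A \<theta>s \<theta> x e"
    and init: "x 0 = x0" "e 0 = 0"
  let ?y = "\<lambda>t. output_error C \<theta>s \<theta> (x t) (e t)"
  obtain V' where V': "\<And>z. (V has_derivative blinfun_apply (V' z)) (at z)"
    using assms(4) unfolding continuously_differentiable_def by blast
  have "L2_norm_sq ?y \<le> ennreal (V (x 0, e 0, \<theta>))"
    unfolding L2_norm_sq_def
    by (rule dissipation_inequality[OF storage_has_derivative_V_dot[OF V' traj]])
      (use assms(3,9) \<theta> in
        \<open>auto intro!: continuous_on_inner continuous_on_output_error[OF traj]\<close>)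
  also have "\<dots> \<le> ennreal ((norm x0)\<^sup>2 * p1 \<theta>)"
    using assms(8)[rule_format, OF \<theta>, of x0 0] init by (intro ennreal_leI) (simp add: mult.commute)
  also have "\<dots> = ennreal ((norm x0)\<^sup>2) * ennreal (p1 \<theta>)"
    by (rule ennreal_mult') simp
  finally have "L2_norm_sq ?y \<le> ennreal ((norm x0)\<^sup>2) * ennreal (p1 \<theta>)" .
  then show "L2_norm_sq ?y / ennreal ((norm x0)\<^sup>2) \<le> ennreal (p1 \<theta>)"
    using x0 by (intro divide_le_posI_ennreal) auto
qed

end
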